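(* Let $\Gamma=(X,E)$ be an $(n,k,\lambda,\mu)$-strongly regular graph (assumed primitive). Fix a vertex $x_0\in X$. Then $\dim\mathcal{T}_2(\Gamma,x_0)\le 2n+3$.
   Context: A $k$-regular finite simple graph with $n$ vertices is strongly regular with parameters $(n,k,\lambda,\mu)$ if any two adjacent vertices have exactly $\lambda$ common neighbours and any two distinct non-adjacent vertices have exactly $\mu$ common neighbours. It is primitive if both the graph and its complement are connected; all strongly regular graphs here are primitive. Let $A$ be the adjacency matrix of $\Gamma$, in the algebra $M_X(\mathbb{C})$ of complex matrices with rows and columns indexed by $X$. For $Y\subset X$, $E_Y\in M_X(\mathbb{C})$ is the diagonal matrix with $(x,x)$-entry $1$ if $x\in Y$ and $0$ otherwise. For $x_0\in X$, let $X_k=\{x\in X:\partial(x_0,x)=k\}$ ($\partial$ the graph distance) and $D=\max_{x\in X}\partial(x_0,x)$. The Terwilliger algebra $\mathcal{T}_2(\Gamma,x_0)=\mathbb{C}\langle A,E_{X_0},\dots,E_{X_D}\rangle$ is the unital $\mathbb{C}$-subalgebra of $M_X(\mathbb{C})$ generated by these matrices. *)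

theory Defs
  imports "HOL-Analysis.Analysis"
begin

text \<open>
  The vertex set \<open>X\<close> is the universe of a finite type \<open>'v\<close>, so that \<open>n = CARD('v)\<close> and
  \<open>M\<^sub>X(\<complex>)\<close> is \<^typ>\<open>complex ^ 'v ^ 'v\<close>. A graph is given by its adjacency relation.
\<close>

definition simple_graph :: "('v \<Rightarrow> 'v \<Rightarrow> bool) \<Rightarrow> bool" where
  "simple_graph E \<longleftrightarrow> symp E \<and> irreflp E"

definition complement_graph :: "('v \<Rightarrow> 'v \<Rightarrow> bool) \<Rightarrow> 'v \<Rightarrow> 'v \<Rightarrow> bool" where
  "complement_graph E x y \<longleftrightarrow> x \<noteq> y \<and> \<not> E x y"

definition connected_graph :: "('v \<Rightarrow> 'v \<Rightarrow> bool) \<Rightarrow> bool" where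
  "connected_graph E \<longleftrightarrow> (\<forall>x y. E\<^sup>*\<^sup>* x y)"

definition regular_graph :: "('v::finite \<Rightarrow> 'v \<Rightarrow> bool) \<Rightarrow> nat \<Rightarrow> bool" where
  "regular_graph E k \<longleftrightarrow> (\<forall>x. card {y. E x y} = k)"

definition strongly_regular ::
  "('v::finite \<Rightarrow> 'v \<Rightarrow> bool) \<Rightarrow> nat \<Rightarrow> nat \<Rightarrow> nat \<Rightarrow> nat \<Rightarrow> bool" where
  "strongly_regular E n k l m \<longleftrightarrow>
     simple_graph E \<and> CARD('v) = n \<and> regular_graph E k \<and>
     (\<forall>x y. E x y \<longrightarrow> card {z. E x z \<and> E y z} = l) \<and>
     (\<forall>x y. x \<noteq> y \<and> \<not> E x y \<longrightarrow> card {z. E x z \<and> E y z} = m)"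

definition primitive_graph :: "('v \<Rightarrow> 'v \<Rightarrow> bool) \<Rightarrow> bool" where
  "primitive_graph E \<longleftrightarrow> connected_graph E \<and> connected_graph (complement_graph E)"

text \<open>
  \<open>(E ^^ d) x y\<close> says that there is a walk of length \<open>d\<close> from \<open>x\<close> to \<open>y\<close>. The value is
  meaningful only if \<open>y\<close> is reachable from \<open>x\<close>.
\<close>

definition graph_dist :: "('v \<Rightarrow> 'v \<Rightarrow> bool) \<Rightarrow> 'v \<Rightarrow> 'v \<Rightarrow> nat" where
  "graph_dist E x y = (LEAST d. (E ^^ d) x y)"

definition sphere_at :: "('v \<Rightarrow> 'v \<Rightarrow> bool) \<Rightarrow> 'v \<Rightarrow> nat \<Rightarrow> 'v set" where
  "sphere_at E x0 i = {x. graph_dist E x0 x = i}"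

definition eccentricity :: "('v::finite \<Rightarrow> 'v \<Rightarrow> bool) \<Rightarrow> 'v \<Rightarrow> nat" where
  "eccentricity E x0 = Max (range (graph_dist E x0))"

definition adjacency_matrix :: "('v::finite \<Rightarrow> 'v \<Rightarrow> bool) \<Rightarrow> complex ^ 'v ^ 'v" where
  "adjacency_matrix E = (\<chi> x y. if E x y then 1 else 0)"

definition diag_idem :: "'v::finite set \<Rightarrow> complex ^ 'v ^ 'v" where
  "diag_idem Y = (\<chi> x y. if x = y \<and> x \<in> Y then 1 else 0)"

definition cscale :: "complex \<Rightarrow> complex ^ 'v ^ 'v::finite \<Rightarrow> complex ^ 'v ^ 'v" where
  "cscale c M = (\<chi> x y. c * M $ x $ y)"

definition unital_subalgebra :: "(complex ^ 'v ^ 'v::finite) set \<Rightarrow> bool" where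
  "unital_subalgebra S \<longleftrightarrow>
     mat 1 \<in> S \<and>
     (\<forall>M\<in>S. \<forall>N\<in>S. M + N \<in> S) \<and>
     (\<forall>c. \<forall>M\<in>S. cscale c M \<in> S) \<and>
     (\<forall>M\<in>S. \<forall>N\<in>S. M ** N \<in> S)"

definition terwilliger_algebra ::
  "('v::finite \<Rightarrow> 'v \<Rightarrow> bool) \<Rightarrow> 'v \<Rightarrow> (complex ^ 'v ^ 'v) set" where
  "terwilliger_algebra E x0 =
     unital_subalgebra hull
       insert (adjacency_matrix E) {diag_idem (sphere_at E x0 i) | i. i \<le> eccentricity E x0}"

text \<open>
  Dimensions of sets of matrices are taken over \<open>\<complex>\<close>; the overloaded constant \<^const>\<open>dim\<close>
  would give the dimension over \<open>\<real>\<close>.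
\<close>

interpretation cmat: vector_space "cscale :: complex \<Rightarrow> complex ^ 'v ^ 'v::finite \<Rightarrow> _"
  by unfold_locales (simp_all add: cscale_def vec_eq_iff algebra_simps)

lemma unital_subalgebra_terwilliger_algebra: "unital_subalgebra (terwilliger_algebra E x0)"
  unfolding terwilliger_algebra_def
  by (rule hull_in) (auto simp: unital_subalgebra_def)

end

theory Submission
  imports Defs "HOL-Computational_Algebra.Fundamental_Theorem_Algebra"
begin

text \<open>
  Write \<open>X\<^sub>1\<close>, \<open>X\<^sub>2\<close> for the sets of vertices at distance 1, 2 from \<open>x\<^sub>0\<close>; let \<open>P\<^sub>i\<close> project
  onto the vectors supported on \<open>X\<^sub>i\<close> with entries summing to zero, a space of dimension
  \<open>\<bar>X\<^sub>i\<bar> - 1\<close>. Matrices constant on the blocks of the partition \<open>{x\<^sub>0}, X\<^sub>1, X\<^sub>2\<close> span a space of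
  dimension at most 9, preserved by \<open>A\<close> because the partition is equitable, and \<open>1 - P\<^sub>1 - P\<^sub>2\<close> is
  one of them. Put \<open>B = P\<^sub>1 A P\<^sub>1\<close>, \<open>C = P\<^sub>1 A P\<^sub>2\<close>, \<open>G = P\<^sub>2 A P\<^sub>1\<close>, \<open>D = P\<^sub>2 A P\<^sub>2\<close>. Compressing
  \<open>A\<^sup>2 = (k - \<mu>) I + (\<lambda> - \<mu>) A + \<mu> J\<close> by the \<open>P\<^sub>i\<close> kills \<open>J\<close> and gives
  \<open>G B + D G = (\<lambda> - \<mu>) G\<close> and \<open>G C + D\<^sup>2 = (k - \<mu>) P\<^sub>2 + (\<lambda> - \<mu>) D\<close>, together with the relations
  obtained by exchanging 1 and 2. Hence the block constant matrices together with all
  \<open>B\<^sup>i P\<^sub>1\<close>, \<open>B\<^sup>i C\<close>, \<open>D\<^sup>i P\<^sub>2\<close>, \<open>D\<^sup>i G\<close> span a space that contains 1 and is closed under left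
  multiplication by the generators, so it contains the Terwilliger algebra. By Cayley-Hamilton
  only the exponents \<open>i < \<bar>X\<^sub>1\<bar> - 1\<close>, respectively \<open>i < \<bar>X\<^sub>2\<bar> - 1\<close>, are needed, and
  \<open>9 + 2 (\<bar>X\<^sub>1\<bar> - 1) + 2 (\<bar>X\<^sub>2\<bar> - 1) = 2 n + 3\<close>.
\<close>

subsection \<open>Complex matrix algebra\<close>

lemma cscale_mult_left: "cscale c M ** N = cscale c (M ** N)"
  by (simp add: cscale_def matrix_matrix_mult_def vec_eq_iff sum_distrib_left mult.assoc)

lemma cscale_mult_right: "M ** cscale c N = cscale c (M ** N)"
  by (simp add: cscale_def matrix_matrix_mult_def vec_eq_iff sum_distrib_left mult_ac)

lemma cscale_mult_vector: "cscale c M *v x = c *s (M *v x)"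
  by (simp add: cscale_def matrix_vector_mult_def vec_eq_iff sum_distrib_left mult.assoc)

lemma matrix_mult_add_left: "(M + M') ** N = M ** N + M' ** (N :: complex ^ 'n ^ 'n::finite)"
  by (simp add: matrix_matrix_mult_def vec_eq_iff distrib_right sum.distrib)

lemma matrix_mult_diff_left: "(M - M') ** N = M ** N - M' ** (N :: complex ^ 'n ^ 'n::finite)"
  by (simp add: matrix_matrix_mult_def vec_eq_iff left_diff_distrib sum_subtractf)

lemma matrix_mult_diff_right: "N ** (M - M') = N ** M - N ** (M' :: complex ^ 'n ^ 'n::finite)"
  by (simp add: matrix_matrix_mult_def vec_eq_iff right_diff_distrib sum_subtractf)

lemma linear_matrix_mult: "Vector_Spaces.linear cscale cscale ((**) M)"
  by unfold_locales (simp_all add: matrix_add_ldistrib cscale_mult_right)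

lemma span_left_mult_closed:
  assumes "\<And>Z. Z \<in> F \<Longrightarrow> M ** Z \<in> cmat.span F" "Y \<in> cmat.span F"
  shows "M ** Y \<in> cmat.span F"
proof -
  interpret L: Vector_Spaces.linear cscale cscale "(**) M" by (rule linear_matrix_mult)
  have "M ** Y \<in> cmat.span ((**) M ` F)"
    using assms(2) by (simp add: L.span_image)
  also have "\<dots> \<subseteq> cmat.span F"
    using assms(1) by (intro cmat.span_minimal) auto
  finally show ?thesis .
qed

text \<open>The matrices that map \<open>S\<close> into itself by left multiplication form a unital
  subalgebra containing \<open>G\<close>, hence the hull; applying its members to
  \<open>mat 1\<close> puts them in \<open>S\<close>. So only left multiplication by the generators
  has to be checked.\<close>

lemma unital_subalgebra_hull_subset:
  assumes S: "cmat.subspace S" "mat 1 \<in> S"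
    and inv: "\<And>M Y. M \<in> G \<Longrightarrow> Y \<in> S \<Longrightarrow> M ** Y \<in> S"
  shows "unital_subalgebra hull G \<subseteq> S"
proof -
  have "unital_subalgebra hull G \<subseteq> {M. \<forall>Y\<in>S. M ** Y \<in> S}"
  proof (rule hull_minimal)
    show "unital_subalgebra {M. \<forall>Y\<in>S. M ** Y \<in> S}"
      using S(1) by (simp add: unital_subalgebra_def matrix_mult_add_left cscale_mult_left
          matrix_mul_assoc[symmetric] cmat.subspace_add cmat.subspace_scale)
  qed (use inv in auto)
  then show ?thesis using S(2) by (force simp: matrix_mul_rid)
qed

subsection \<open>Powers of a matrix on an invariant subspace\<close>

text \<open>The vector \<open>p(M) v\<close>, evaluated by Horner's scheme.\<close>

definition poly_mv :: "complex poly \<Rightarrow> complex ^ 'n ^ 'n \<Rightarrow> complex ^ 'n \<Rightarrow> complex ^ 'n" where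
  "poly_mv p M v = fold_coeffs (\<lambda>a x. a *s v + M *v x) p 0"

lemma poly_mv_0 [simp]: "poly_mv 0 M v = 0"
  by (simp add: poly_mv_def)

lemma poly_mv_pCons [simp]: "poly_mv (pCons a p) M v = a *s v + M *v poly_mv p M v"
  by (cases "p = 0 \<and> a = 0") (auto simp: poly_mv_def)

lemma poly_mv_add: "poly_mv (p + q) M v = poly_mv p M v + poly_mv q M v"
proof (induction p arbitrary: q)
  case (pCons a p)
  then show ?case
    by (cases q) (simp add: matrix_vector_right_distrib vec.scale_left_distrib)
qed simp

lemma poly_mv_smult: "poly_mv (smult c p) M v = c *s poly_mv p M v"
  by (induction p) (simp_all add: vec.scale_right_distrib vector_scalar_commute)

lemma poly_mv_linear_mult:
  "poly_mv ([:- c, 1:] * p) M v = M *v poly_mv p M v - c *s poly_mv p M v"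
  by (simp add: poly_mv_add poly_mv_smult del: add_uminus_conv_diff smult_minus_left)

lemma poly_mv_monom: "poly_mv (monom 1 i) M v = ((*v) M ^^ i) v"
  by (induction i) (simp_all add: monom_Suc monom_0)

lemma poly_mv_mem:
  assumes "vec.subspace U" "\<And>u. u \<in> U \<Longrightarrow> M *v u \<in> U" "v \<in> U"
  shows "poly_mv p M v \<in> U"
  using assms by (induction p) (auto intro!: vec.subspace_add vec.subspace_scale vec.subspace_0)

text \<open>The condition \<open>coeff p e = 0\<close> ensures that \<open>monom 1 e - p\<close> is
  nonzero. Unlike \<open>degree p < e\<close> it also makes sense for \<open>e = 0\<close>.\<close>

lemma span_powers_imp_poly_mv:
  assumes "u \<in> vec.span ((\<lambda>i. ((*v) M ^^ i) v) ` {..<e})"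
  shows "\<exists>p. coeff p e = 0 \<and> poly_mv p M v = u"
  using assms
proof (induction rule: vec.span_induct_alt)
  case base
  show ?case by (rule exI[of _ 0]) simp
next
  case (step c x y)
  then obtain p i where "coeff p e = 0" "poly_mv p M v = y" "i < e" "x = ((*v) M ^^ i) v"
    by auto
  then show ?case
    by (intro exI[of _ "smult c (monom 1 i) + p"]) (simp add: poly_mv_add poly_mv_smult poly_mv_monom)
qed

text \<open>If no iterate of \<open>v\<close> lay in the span of the earlier ones, there would be
  independent sets of every size. The first dependence found gives the polynomial.\<close>

lemma ex_annihilating_poly:
  fixes v :: "complex ^ 'n"
  shows "\<exists>p. p \<noteq> 0 \<and> poly_mv p M v = 0"
proof -
  define f where "f i = ((*v) M ^^ i) v" for i
  have "\<exists>e. f e \<in> vec.span (f ` {..<e})"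
  proof (rule ccontr)
    assume nex: "\<not> ?thesis"
    have "vec.independent (f ` {..<e}) \<and> card (f ` {..<e}) = e" for e
    proof (induction e)
      case (Suc e)
      have e: "f e \<notin> vec.span (f ` {..<e})" using nex by simp
      then have "f e \<notin> f ` {..<e}" using vec.span_base[of "f e" "f ` {..<e}"] by metis
      with Suc e show ?case
        by (simp add: lessThan_Suc vec.independent_insertI)
    qed (simp add: vec.independent_empty)
    then have "e \<le> vec.dim (UNIV :: (complex ^ 'n) set)" for e
      by (metis subset_UNIV vec.independent_card_le_dim)
    then show False by (metis Suc_n_not_le_n)
  qed
  then obtain e p where p: "coeff p e = 0" "poly_mv p M v = f e"
    using span_powers_imp_poly_mv unfolding f_def by metis
  define q where "q = monom 1 e + smult (-1) p"
  have "poly_mv q M v = 0"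
    unfolding q_def poly_mv_add poly_mv_smult poly_mv_monom p by (simp add: f_def)
  moreover have "coeff q e = 1" by (simp add: q_def p)
  ultimately show ?thesis by (metis coeff_0 zero_neq_one)
qed

text \<open>Split a linear factor off an annihilating polynomial of \<open>v\<close>. Either the
  quotient \<open>q\<close> still annihilates \<open>v\<close> and has smaller degree, or
  \<open>q(M) v\<close> is an eigenvector, which lies in \<open>U\<close> by invariance.\<close>

lemma invariant_subspace_eigenvector:
  fixes M :: "complex ^ 'n ^ 'n"
  assumes U: "vec.subspace U" "\<And>u. u \<in> U \<Longrightarrow> M *v u \<in> U" and v: "v \<in> U" "v \<noteq> 0"
  shows "\<exists>c. \<exists>w\<in>U. w \<noteq> 0 \<and> M *v w = c *s w"
proof -
  obtain p where "p \<noteq> 0" "poly_mv p M v = 0"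
    using ex_annihilating_poly by blast
  then show ?thesis
  proof (induction "degree p" arbitrary: p rule: less_induct)
    case less
    have "degree p \<noteq> 0"
    proof
      assume "degree p = 0"
      then obtain a where "p = [:a:]" by (rule degree_eq_zeroE)
      with less.prems v show False by simp
    qed
    then have "\<not> constant (poly p)" by (simp add: constant_degree)
    then obtain c where "poly p c = 0"
      using fundamental_theorem_of_algebra by blast
    then obtain q where q: "p = [:- c, 1:] * q"
      by (auto simp: poly_eq_0_iff_dvd elim: dvdE)
    have q0: "q \<noteq> 0" using q less.prems by auto
    show ?case
    proof (cases "poly_mv q M v = 0")
      case True
      have "degree q < degree p" unfolding q using q0 by (subst degree_mult_eq) auto
      then show ?thesis using less.hyps q0 True by blast
    next
      case False
      have "M *v poly_mv q M v = c *s poly_mv q M v"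
        using less.prems(2) unfolding q poly_mv_linear_mult by simp
      then show ?thesis using False poly_mv_mem[OF U v(1)] by blast
    qed
  qed
qed

text \<open>A monic polynomial in \<open>M\<close>, given by the list of its roots. The factor of
  the head stands rightmost and so acts first, which suits an induction that replaces
  \<open>U\<close> by its image under that factor.\<close>

primrec shift_prod :: "complex ^ 'n ^ 'n::finite \<Rightarrow> complex list \<Rightarrow> complex ^ 'n ^ 'n" where
  "shift_prod M [] = mat 1"
| "shift_prod M (c # cs) = shift_prod M cs ** (M - cscale c (mat 1))"

text \<open>
  A substitute for Cayley-Hamilton: if \<open>w \<in> U\<close> has eigenvalue \<open>c\<close>, then \<open>M - c\<close> kills \<open>w\<close> and
  maps \<open>U\<close> onto an invariant subspace of smaller dimension.
\<close>

lemma shift_prod_annihilates: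
  fixes M :: "complex ^ 'n ^ 'n"
  assumes "vec.subspace U" "\<And>u. u \<in> U \<Longrightarrow> M *v u \<in> U" "vec.dim U \<le> d"
  shows "\<exists>cs. length cs = d \<and> (\<forall>u\<in>U. shift_prod M cs *v u = 0)"
  using assms
proof (induction d arbitrary: U)
  case 0
  then have "U \<subseteq> {0}" by (metis le_zero_eq vec.dim_eq_0)
  then show ?case by auto
next
  case (Suc d)
  show ?case
  proof (cases "U \<subseteq> {0}")
    case True
    \<comment> \<open>On the zero space any list will do; only its length matters.\<close>
    then show ?thesis by (intro exI[of _ "replicate (Suc d) 0"]) auto
  next
    case False
    then obtain c w where w: "w \<in> U" "w \<noteq> 0" "M *v w = c *s w"
      using invariant_subspace_eigenvector Suc.prems by blast
    define N where "N = M - cscale c (mat 1)"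
    have N: "N *v u = M *v u - c *s u" for u
      by (simp add: N_def matrix_vector_mult_diff_rdistrib cscale_mult_vector)
    have "vec.independent {w}" using w by (simp add: vec.independent_insert vec.independent_empty)
    then obtain B where B: "{w} \<subseteq> B" "B \<subseteq> U" "vec.independent B" "U \<subseteq> vec.span B"
      using vec.maximal_independent_subset_extend[of "{w}" U] w by auto
    have fin: "finite B" using B(3) by (rule vec.finiteI_independent)
    have "card B \<le> Suc d"
      using vec.independent_card_le_dim[OF B(2,3)] Suc.prems(3) by linarith
    then have card: "card (B - {w}) \<le> d" using B(1) fin by simp
    have "N *v w = 0" by (simp add: N w)
    then have "(*v) N ` B \<subseteq> insert 0 ((*v) N ` (B - {w}))" by auto
    then have "vec.span ((*v) N ` B) \<subseteq> vec.span ((*v) N ` (B - {w}))"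
      by (metis vec.span_mono vec.span_insert_0)
    moreover have "(*v) N ` U \<subseteq> vec.span ((*v) N ` B)"
      using B(4) by (simp add: vec.span_image image_mono)
    ultimately have "vec.dim ((*v) N ` U) \<le> card ((*v) N ` (B - {w}))"
      using fin by (intro vec.dim_le_card) auto
    also have "\<dots> \<le> d" using card fin card_image_le[of "B - {w}" "(*v) N"] by simp
    finally have "vec.dim ((*v) N ` U) \<le> d" .
    moreover have "vec.subspace ((*v) N ` U)"
      using Suc.prems(1) by (rule vec.subspace_image)
    moreover have "M *v u \<in> (*v) N ` U" if u: "u \<in> (*v) N ` U" for u
    proof -
      obtain u' where u': "u' \<in> U" "u = N *v u'" using u by blast
      have "M *v u = N *v (M *v u')"
        by (simp add: u' N vec.diff vec.scale)
      then show ?thesis using u' Suc.prems(2) by blast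
    qed
    ultimately obtain cs where "length cs = d" "\<forall>u\<in>(*v) N ` U. shift_prod M cs *v u = 0"
      using Suc.IH by blast
    then show ?thesis
      by (intro exI[of _ "c # cs"]) (auto simp: N_def matrix_vector_mul_assoc)
  qed
qed

section \<open>Reducing all powers of a matrix to the first few\<close>

definition krylov :: "complex ^ 'n ^ 'n::finite \<Rightarrow> complex ^ 'n ^ 'n \<Rightarrow> nat \<Rightarrow> (complex ^ 'n ^ 'n) set" where
  "krylov M X d = (\<lambda>i. ((**) M ^^ i) X) ` {..<d}"

lemma krylov_finite [simp]: "finite (krylov M X d)"
  by (simp add: krylov_def)

lemma card_krylov: "card (krylov M X d) \<le> d"
  unfolding krylov_def by (metis card_image_le card_lessThan finite_lessThan)

text \<open>The product is monic in \<open>M\<close> of degree \<open>length cs\<close>, so removing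
  the leading power leaves only lower ones.\<close>

lemma shift_prod_mult:
  "((**) M ^^ length cs) X - shift_prod M cs ** X \<in> cmat.span (krylov M X (length cs))"
proof (induction cs arbitrary: X)
  case (Cons c cs)
  let ?d = "length cs"
  have *: "krylov M (M ** X) ?d \<subseteq> krylov M X (Suc ?d)"
    by (force simp: krylov_def funpow_swap1)
  have "((**) M ^^ ?d) (M ** X) - shift_prod M cs ** (M ** X) \<in> cmat.span (krylov M X (Suc ?d))"
    using Cons.IH[of "M ** X"] cmat.span_mono[OF *] by blast
  \<comment> \<open>The difference is just \<open>shift_prod M cs ** X\<close>, written so that the
    induction hypothesis for \<open>X\<close> applies.\<close>
  moreover have "((**) M ^^ ?d) X - (((**) M ^^ ?d) X - shift_prod M cs ** X)
      \<in> cmat.span (krylov M X (Suc ?d))"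
  proof (rule cmat.span_diff)
    show "((**) M ^^ ?d) X \<in> cmat.span (krylov M X (Suc ?d))"
      by (auto simp: krylov_def intro: cmat.span_base)
    have "krylov M X ?d \<subseteq> krylov M X (Suc ?d)" by (auto simp: krylov_def)
    then show "((**) M ^^ ?d) X - shift_prod M cs ** X \<in> cmat.span (krylov M X (Suc ?d))"
      using Cons.IH[of X] cmat.span_mono by blast
  qed
  ultimately have "((**) M ^^ ?d) (M ** X) - shift_prod M cs ** (M ** X)
      + cscale c (((**) M ^^ ?d) X - (((**) M ^^ ?d) X - shift_prod M cs ** X))
      \<in> cmat.span (krylov M X (Suc ?d))"
    by (intro cmat.span_add cmat.span_scale)
  moreover have "shift_prod M (c # cs) ** X = shift_prod M cs ** (M ** X) - cscale c (shift_prod M cs ** X)"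
    by (simp add: matrix_mul_assoc[symmetric] matrix_mult_diff_left matrix_mult_diff_right cscale_mult_left cscale_mult_right)
  ultimately show ?case by (simp add: funpow_swap1 diff_diff_eq2 add_diff_eq diff_add_eq del: shift_prod.simps)
qed (simp add: cmat.span_zero)

text \<open>The annihilating product for \<open>U\<close> kills every column of \<open>X\<close>.
  Hence the \<open>d\<close>-th power reduces to lower ones, and the span of these is closed under
  left multiplication by \<open>M\<close>.\<close>

lemma power_mult_mem_span_krylov:
  fixes M X :: "complex ^ 'n ^ 'n"
  assumes "vec.subspace U" "\<And>u. u \<in> U \<Longrightarrow> M *v u \<in> U" "vec.dim U \<le> d"
    and "\<And>j. column j X \<in> U"
  shows "((**) M ^^ i) X \<in> cmat.span (krylov M X d)"
proof -
  obtain cs where cs: "length cs = d" "\<forall>u\<in>U. shift_prod M cs *v u = 0"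
    using shift_prod_annihilates[OF assms(1-3)] by blast
  have "column j (shift_prod M cs ** X) = 0" for j
  proof -
    have "column j (shift_prod M cs ** X) = shift_prod M cs *v column j X"
      by (simp add: column_def matrix_matrix_mult_def matrix_vector_mult_def vec_eq_iff)
    then show ?thesis using cs(2) assms(4) by simp
  qed
  then have "shift_prod M cs ** X = 0" by (simp add: column_def vec_eq_iff)
  then have d: "((**) M ^^ d) X \<in> cmat.span (krylov M X d)"
    using shift_prod_mult[where M = M and cs = cs and X = X] cs(1) by simp
  have step: "M ** Y \<in> cmat.span (krylov M X d)" if "Y \<in> krylov M X d" for Y
  proof -
    obtain i where i: "i < d" "Y = ((**) M ^^ i) X" using \<open>Y \<in> _\<close> by (auto simp: krylov_def)
    then have "M ** Y = ((**) M ^^ Suc i) X" by simp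
    then show ?thesis using d i
      by (cases "Suc i = d") (auto simp: krylov_def intro!: cmat.span_base simp del: funpow.simps)
  qed
  show ?thesis
  proof (induction i)
    case 0
    show ?case
    proof (cases "d = 0")
      \<comment> \<open>The Krylov set is empty here, and fact \<open>d\<close> states the
        membership of \<open>X\<close> itself.\<close>
      case True then show ?thesis using d by simp
    next
      case False then show ?thesis
        by (auto simp: krylov_def intro!: cmat.span_base image_eqI[where x = 0])
    qed
  qed (simp add: span_left_mult_closed step)
qed

subsection \<open>Corners of a quadratic matrix\<close>

text \<open>With \<open>B\<close>, \<open>D\<close>, \<open>G\<close> as in the proof,
  \<open>A\<close> sends \<open>B^i X\<close> to \<open>B^(i+1) X + G B^i X\<close>. The relation
  \<open>G B = \<nu> G - D G\<close> moves \<open>G\<close> to the right through the powers of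
  \<open>B\<close>, which turns the second term into a combination of the
  \<open>D^s (R A X)\<close>.\<close>

lemma corner_power_mult_mem:
  fixes A P R X :: "complex ^ 'n ^ 'n::finite"
  assumes W: "cmat.subspace W"
    and idem: "P ** P = P" "R ** R = R"
    and AP: "A ** P = P ** A ** P + R ** A ** P"
    and RAAP: "R ** A ** A ** P = cscale \<nu> (R ** A ** P)"
    and X: "P ** X = X"
    and BX: "\<And>i. ((**) (P ** A ** P) ^^ i) X \<in> W"
    and DX: "\<And>i. ((**) (R ** A ** R) ^^ i) (R ** A ** X) \<in> W"
  shows "A ** ((**) (P ** A ** P) ^^ i) X \<in> W"
proof -
  define B where "B = P ** A ** P"
  define D where "D = R ** A ** R"
  define G where "G = R ** A ** P"
  have GB: "G ** B = cscale \<nu> G - D ** G"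
  proof -
    have "R ** A ** A ** P = (R ** A) ** (P ** A ** P + R ** A ** P)"
      by (simp add: AP[symmetric] matrix_mul_assoc)
    also have "\<dots> = R ** A ** (P ** P) ** A ** P + R ** A ** (R ** R) ** A ** P"
      by (simp add: idem matrix_add_ldistrib matrix_mul_assoc)
    also have "\<dots> = G ** B + D ** G"
      by (simp add: G_def B_def D_def matrix_mul_assoc)
    finally show ?thesis using RAAP by (simp add: G_def)
  qed
  have PB: "P ** ((**) B ^^ i) X = ((**) B ^^ i) X" for i
    by (cases i) (simp_all add: X B_def matrix_mul_assoc idem)
  let ?cyc = "cmat.span (range (\<lambda>i. ((**) D ^^ i) (R ** A ** X)))"
  have GX: "G ** X = R ** A ** X"
    by (simp add: G_def matrix_mul_assoc[symmetric] X)
  have Dcyc: "D ** Y \<in> ?cyc" if "Y \<in> ?cyc" for Y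
  proof (rule span_left_mult_closed[OF _ that])
    fix Z assume "Z \<in> range (\<lambda>i. ((**) D ^^ i) (R ** A ** X))"
    then obtain i where "Z = ((**) D ^^ i) (R ** A ** X)" by blast
    then have "D ** Z = ((**) D ^^ Suc i) (R ** A ** X)" by simp
    then show "D ** Z \<in> ?cyc" using cmat.span_base by (metis rangeI)
  qed
  have GBX: "G ** ((**) B ^^ i) X \<in> ?cyc" for i
  proof (induction i)
    case 0
    show ?case by (auto simp: GX intro!: cmat.span_base range_eqI[where x = 0])
  next
    case (Suc i)
    have "G ** ((**) B ^^ Suc i) X = cscale \<nu> (G ** ((**) B ^^ i) X) - D ** (G ** ((**) B ^^ i) X)"
      by (simp add: matrix_mul_assoc GB matrix_mult_diff_left cscale_mult_left)
    then show ?case by (simp add: Suc Dcyc cmat.span_diff cmat.span_scale del: funpow.simps)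
  qed
  have "?cyc \<subseteq> W"
    using W DX by (intro cmat.span_minimal) (auto simp: D_def)
  then have "G ** ((**) B ^^ i) X \<in> W" using GBX by blast
  moreover have "B ** ((**) B ^^ i) X \<in> W" using BX[of "Suc i"] by (simp add: B_def)
  moreover have "A ** ((**) B ^^ i) X = B ** ((**) B ^^ i) X + G ** ((**) B ^^ i) X"
  proof -
    have "A ** ((**) B ^^ i) X = A ** P ** ((**) B ^^ i) X"
      by (metis PB matrix_mul_assoc)
    then show ?thesis by (simp only: AP matrix_mult_add_left B_def G_def)
  qed
  ultimately show ?thesis using W by (simp add: B_def cmat.subspace_add)
qed

text \<open>The case \<open>X = P A R\<close> of the preceding lemma. Here
  \<open>R A X = \<alpha> R + \<nu> D - D^2\<close> by the quadratic relation in the corner of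
  \<open>R\<close>, so the powers \<open>D^s R\<close> suffice.\<close>

lemma corner_power_mult_mem_off_diagonal:
  fixes A P R :: "complex ^ 'n ^ 'n::finite"
  assumes W: "cmat.subspace W"
    and idem: "P ** P = P" "R ** R = R"
    and AP: "A ** P = P ** A ** P + R ** A ** P"
    and AR: "A ** R = P ** A ** R + R ** A ** R"
    and RAAP: "R ** A ** A ** P = cscale \<nu> (R ** A ** P)"
    and RAAR: "R ** A ** A ** R = cscale \<alpha> R + cscale \<nu> (R ** A ** R)"
    and BC: "\<And>i. ((**) (P ** A ** P) ^^ i) (P ** A ** R) \<in> W"
    and DR: "\<And>i. ((**) (R ** A ** R) ^^ i) R \<in> W"
  shows "A ** ((**) (P ** A ** P) ^^ i) (P ** A ** R) \<in> W"
proof (rule corner_power_mult_mem[OF W idem AP RAAP _ BC])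
  show "P ** (P ** A ** R) = P ** A ** R"
    by (simp add: matrix_mul_assoc idem)
  fix i
  define D where "D = R ** A ** R"
  have "R ** A ** A ** R = R ** A ** (P ** A ** R + R ** A ** R)"
    by (simp add: AR[symmetric] matrix_mul_assoc)
  also have "\<dots> = R ** A ** (P ** A ** R) + R ** A ** (R ** R) ** A ** R"
    by (simp add: idem matrix_add_ldistrib matrix_mul_assoc)
  also have "\<dots> = R ** A ** (P ** A ** R) + D ** D"
    by (simp add: D_def matrix_mul_assoc)
  finally have "R ** A ** (P ** A ** R) = cscale \<alpha> R + cscale \<nu> D - D ** D"
    using RAAR by (simp add: D_def)
  \<comment> \<open>Each term becomes a power of \<open>D\<close> applied to \<open>R\<close>, the
    form in which \<open>DR\<close> supplies membership.\<close>
  also have "\<dots> = cscale \<alpha> R + cscale \<nu> (D ** R) - D ** (D ** R)"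
    by (simp add: D_def matrix_mul_assoc[symmetric] idem)
  finally have eq: "R ** A ** (P ** A ** R) = cscale \<alpha> R + cscale \<nu> (D ** R) - D ** (D ** R)" .
  have "((**) D ^^ i) (cscale \<alpha> R + cscale \<nu> (D ** R) - D ** (D ** R))
     = cscale \<alpha> (((**) D ^^ i) R) + cscale \<nu> (((**) D ^^ Suc i) R) - ((**) D ^^ Suc (Suc i)) R"
    by (induction i) (simp_all add: matrix_add_ldistrib cscale_mult_right matrix_mult_diff_right)
  then show "((**) (R ** A ** R) ^^ i) (R ** A ** (P ** A ** R)) \<in> W"
    unfolding eq using W DR[folded D_def]
    by (metis D_def cmat.subspace_add cmat.subspace_diff cmat.subspace_scale)
qed

subsection \<open>Matrices and partitions of the index set\<close>

definition block_constant :: "('v \<Rightarrow> nat) \<Rightarrow> complex ^ 'v ^ 'v::finite \<Rightarrow> bool" where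
  "block_constant f M \<longleftrightarrow> (\<exists>g. \<forall>x y. M $ x $ y = g (f x) (f y))"

text \<open>An empty block gives the zero matrix, although \<open>1 / 0 = 0\<close> occurs in the formula.\<close>

definition block_centering :: "('v::finite \<Rightarrow> nat) \<Rightarrow> nat \<Rightarrow> complex ^ 'v ^ 'v" where
  "block_centering f i =
     (\<chi> x y. (if x = y \<and> f x = i then 1 else 0)
       - (if f x = i \<and> f y = i then 1 / of_nat (card {z. f z = i}) else 0))"

definition block_indicator :: "('v::finite \<Rightarrow> nat) \<Rightarrow> nat \<Rightarrow> nat \<Rightarrow> complex ^ 'v ^ 'v" where
  "block_indicator f i j = (\<chi> x y. if f x = i \<and> f y = j then 1 else 0)"

lemma block_card_nonzero: "f x = i \<Longrightarrow> card {z::'v::finite. f z = i} \<noteq> 0"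
  by auto

lemma block_centering_outside: "f y \<noteq> i \<Longrightarrow> block_centering f i $ x $ y = 0"
  by (auto simp: block_centering_def)

lemma mult_block_centering:
  fixes M :: "complex ^ 'v ^ 'v::finite"
  shows "(M ** block_centering f i) $ x $ y =
    (if f y = i then M $ x $ y - (\<Sum>z | f z = i. M $ x $ z) / of_nat (card {z. f z = i}) else 0)"
proof -
  let ?c = "of_nat (card {z. f z = i}) :: complex"
  have "(M ** block_centering f i) $ x $ y =
     (\<Sum>z\<in>UNIV. (if z = y then (if f y = i then M $ x $ z else 0) else 0)
        - (if f z = i then (if f y = i then M $ x $ z / ?c else 0) else 0))"
    unfolding matrix_matrix_mult_def block_centering_def vec_lambda_beta
    by (rule sum.cong) (auto simp: algebra_simps)
  also have "\<dots> = (if f y = i then M $ x $ y else 0)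
       - (\<Sum>z | f z = i. if f y = i then M $ x $ z / ?c else 0)"
    by (simp add: sum_subtractf sum.If_cases)
  finally show ?thesis by (simp add: sum_divide_distrib)
qed

lemma block_centering_mult_vector:
  fixes v :: "complex ^ 'v::finite"
  shows "(block_centering f i *v v) $ x =
    (if f x = i then v $ x - (\<Sum>z | f z = i. v $ z) / of_nat (card {z. f z = i}) else 0)"
proof -
  let ?c = "of_nat (card {z. f z = i}) :: complex"
  have "(block_centering f i *v v) $ x =
     (\<Sum>z\<in>UNIV. (if z = x then (if f x = i then v $ z else 0) else 0)
        - (if f z = i then (if f x = i then v $ z / ?c else 0) else 0))"
    unfolding matrix_vector_mult_def block_centering_def vec_lambda_beta
    by (rule sum.cong) (auto simp: algebra_simps)
  also have "\<dots> = (if f x = i then v $ x else 0)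
       - (\<Sum>z | f z = i. if f x = i then v $ z / ?c else 0)"
    by (simp add: sum_subtractf sum.If_cases)
  finally show ?thesis by (simp add: sum_divide_distrib)
qed

lemma sum_block_centering_mult_vector:
  fixes v :: "complex ^ 'v::finite"
  shows "(\<Sum>x | f x = i. (block_centering f i *v v) $ x) = 0"
  using block_card_nonzero[of f _ i]
  by (cases "{z. f z = i} = {}") (auto simp: block_centering_mult_vector sum_subtractf)

lemma sum_block_centering_row: "(\<Sum>z | f z = i. block_centering f i $ x $ z) = 0"
proof (cases "f x = i")
  case True
  then show ?thesis
    using block_card_nonzero[of f x i]
    by (simp add: block_centering_def sum_subtractf sum.delta)
qed (simp add: block_centering_def)

lemma block_centering_idem: "block_centering f i ** block_centering f i = block_centering f i"
  by (simp add: vec_eq_iff mult_block_centering sum_block_centering_row) (simp add: block_centering_def)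

lemma block_centering_orthogonal: "i \<noteq> j \<Longrightarrow> block_centering f i ** block_centering f j = 0"
  by (simp add: vec_eq_iff mult_block_centering block_centering_outside)

text \<open>Each row of \<open>M\<close> is constant on block \<open>i\<close>, and the product
  subtracts its mean there. This is what makes \<open>J\<close> and other block constant terms
  vanish in the corners.\<close>

lemma block_constant_mult_block_centering:
  assumes "block_constant f M"
  shows "M ** block_centering f i = 0"
proof -
  obtain g where "M $ x $ y = g (f x) (f y)" for x y
    using assms by (auto simp: block_constant_def)
  then show ?thesis
    using block_card_nonzero[of f _ i] by (auto simp: vec_eq_iff mult_block_centering)
qed

lemma diag_idem_mult: "(diag_idem Y ** M) $ x $ y = (if x \<in> Y then M $ x $ y else 0)"
proof -
  have "(diag_idem Y ** M) $ x $ y = (\<Sum>z\<in>UNIV. if x = z then (if x \<in> Y then M $ z $ y else 0) else 0)"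
    unfolding matrix_matrix_mult_def diag_idem_def vec_lambda_beta by (rule sum.cong) auto
  then show ?thesis by simp
qed

lemma diag_idem_mult_block_centering:
  "diag_idem {x. f x = j} ** block_centering f i = (if i = j then block_centering f i else 0)"
  by (simp add: vec_eq_iff diag_idem_mult) (auto simp: block_centering_def)

lemma block_constant_diag_idem_mult:
  assumes "block_constant f M"
  shows "block_constant f (diag_idem {x. f x = j} ** M)"
proof -
  obtain g where "M $ x $ y = g (f x) (f y)" for x y
    using assms by (auto simp: block_constant_def)
  then show ?thesis
    by (auto simp: block_constant_def diag_idem_mult intro!: exI[of _ "\<lambda>a b. if a = j then g a b else 0"])
qed

lemma block_constant_transpose: "block_constant f M \<Longrightarrow> block_constant f (transpose M)"
  by (auto simp: block_constant_def transpose_def)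

text \<open>Grouping the neighbours of \<open>x\<close> by block multiplies \<open>g\<close> by the
  quotient matrix \<open>q\<close> of the equitable partition.\<close>

lemma adjacency_mult_block_constant:
  assumes M: "block_constant f M"
    and equitable: "\<And>x j. card {z. E x z \<and> f z = j} = q (f x) j"
  shows "block_constant f (adjacency_matrix E ** M)"
proof -
  obtain g where g: "M $ x $ y = g (f x) (f y)" for x y
    using M by (auto simp: block_constant_def)
  have "(adjacency_matrix E ** M) $ x $ y = (\<Sum>j\<in>range f. of_nat (q (f x) j) * g j (f y))" for x y
  proof -
    have "(adjacency_matrix E ** M) $ x $ y = (\<Sum>z\<in>UNIV. (if E x z then 1 else 0) * g (f z) (f y))"
      by (simp add: matrix_matrix_mult_def adjacency_matrix_def g)
    also have "\<dots> = (\<Sum>z | E x z. g (f z) (f y))"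
      by (simp add: sum.If_cases if_distrib[of "\<lambda>a. a * _"] cong: if_cong)
    also have "\<dots> = (\<Sum>j\<in>range f. \<Sum>z\<in>{z \<in> {z. E x z}. f z = j}. g (f z) (f y))"
      by (rule sum.group[symmetric]) auto
    also have "\<dots> = (\<Sum>j\<in>range f. of_nat (q (f x) j) * g j (f y))"
      by (intro sum.cong) (auto simp: equitable)
    finally show ?thesis .
  qed
  then show ?thesis
    by (auto simp: block_constant_def intro!: exI[of _ "\<lambda>a b. \<Sum>j\<in>range f. of_nat (q a j) * g j b"])
qed

lemma block_constant_mult_adjacency:
  assumes "symp E" "block_constant f M" "\<And>x j. card {z. E x z \<and> f z = j} = q (f x) j"
  shows "block_constant f (M ** adjacency_matrix E)"
proof -
  have "transpose (adjacency_matrix E) = adjacency_matrix E"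
    using assms(1) by (auto simp: transpose_def adjacency_matrix_def vec_eq_iff dest: sympD)
  then have "M ** adjacency_matrix E = transpose (adjacency_matrix E ** transpose M)"
    by (simp add: matrix_transpose_mul)
  then show ?thesis
    using assms by (simp add: block_constant_transpose adjacency_mult_block_constant)
qed

lemma block_constant_mem_span:
  assumes M: "block_constant f M" and f: "\<And>x. f x < N"
  shows "M \<in> cmat.span ((\<lambda>(i, j). block_indicator f i j) ` ({..<N} \<times> {..<N}))"
proof -
  obtain g where g: "M $ x $ y = g (f x) (f y)" for x y
    using M by (auto simp: block_constant_def)
  have "M = (\<Sum>(i, j)\<in>{..<N} \<times> {..<N}. cscale (g i j) (block_indicator f i j))"
  proof -
    have "(\<Sum>(i, j)\<in>{..<N} \<times> {..<N}. cscale (g i j) (block_indicator f i j)) $ x $ y = M $ x $ y"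
      for x y
    proof -
      have "(\<Sum>(i, j)\<in>{..<N} \<times> {..<N}. cscale (g i j) (block_indicator f i j)) $ x $ y
          = (\<Sum>p\<in>{..<N} \<times> {..<N}. if p = (f x, f y) then g (fst p) (snd p) else 0)"
        unfolding sum_component by (rule sum.cong) (auto simp: cscale_def block_indicator_def split: if_splits)
      then show ?thesis using f by (simp add: g)
    qed
    then show ?thesis by (simp add: vec_eq_iff)
  qed
  also have "\<dots> \<in> cmat.span ((\<lambda>(i, j). block_indicator f i j) ` ({..<N} \<times> {..<N}))"
    by (intro cmat.span_sum) (auto intro: cmat.span_scale cmat.span_base)
  finally show ?thesis .
qed

text \<open>A vector supported on the block with entries summing to zero is a combination of the
  differences \<open>axis x 1 - axis a 1\<close> for a fixed \<open>a\<close> in the block.\<close>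

lemma dim_range_block_centering:
  fixes f :: "'v::finite \<Rightarrow> nat"
  shows "vec.dim (range ((*v) (block_centering f i))) \<le> card {x. f x = i} - 1"
proof (cases "{x. f x = i} = {}")
  \<comment> \<open>For an empty block the bound is the truncated difference
    \<open>0 - 1 = 0\<close>.\<close>
  case True
  then have "block_centering f i = 0" by (auto simp: block_centering_def vec_eq_iff)
  then show ?thesis by (simp add: image_constant_conv)
next
  case False
  then obtain a where a: "f a = i" by blast
  let ?Y = "{x. f x = i} - {a}"
  let ?b = "\<lambda>x. axis x 1 - axis a (1 :: complex)"
  have "range ((*v) (block_centering f i)) \<subseteq> vec.span (?b ` ?Y)"
  proof clarify
    fix v :: "complex ^ 'v"
    define u where "u = block_centering f i *v v"
    have supp: "u $ x = 0" if "f x \<noteq> i" for x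
      using that by (simp add: u_def block_centering_mult_vector)
    have "(\<Sum>x | f x = i. u $ x) = u $ a + (\<Sum>x\<in>?Y. u $ x)"
      using a by (intro sum.remove) auto
    then have ua: "u $ a = - (\<Sum>x\<in>?Y. u $ x)"
      by (simp add: u_def sum_block_centering_mult_vector add_eq_0_iff2)
    have "u = (\<Sum>x\<in>?Y. u $ x *s ?b x)"
    proof -
      have "(\<Sum>x\<in>?Y. u $ x *s ?b x) $ y = u $ y" for y
      proof -
        have "(\<Sum>x\<in>?Y. u $ x *s ?b x) $ y
            = (\<Sum>x\<in>?Y. (if x = y then u $ x else 0) - (if a = y then u $ x else 0))"
          unfolding sum_component by (rule sum.cong) (auto simp: axis_def)
        then show ?thesis using ua supp a by (cases "a = y") (auto simp: sum_subtractf sum_negf)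
      qed
      then show ?thesis by (simp add: vec_eq_iff)
    qed
    also have "\<dots> \<in> vec.span (?b ` ?Y)"
      by (intro vec.span_sum vec.span_scale vec.span_base) auto
    finally show "u \<in> vec.span (?b ` ?Y)" .
  qed
  then have "vec.dim (range ((*v) (block_centering f i))) \<le> card (?b ` ?Y)"
    by (intro vec.dim_le_card) auto
  also have "\<dots> \<le> card ?Y" by (rule card_image_le) simp
  also have "\<dots> = card {x. f x = i} - 1" using a by simp
  finally show ?thesis .
qed

text \<open>The range of \<open>P\<close> is invariant under the corner \<open>P A P\<close> and
  contains the columns of \<open>P Y\<close>, so its dimension bounds the number of powers
  required.\<close>

lemma corner_power_mem_span_krylov:
  fixes A Y :: "complex ^ 'v ^ 'v::finite" and f :: "'v \<Rightarrow> nat" and i :: nat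
  defines "P \<equiv> block_centering f i"
  shows "((**) (P ** A ** P) ^^ r) (P ** Y) \<in> cmat.span (krylov (P ** A ** P) (P ** Y) (card {x. f x = i} - 1))"
proof (rule power_mult_mem_span_krylov[where U = "range ((*v) P)"])
  show "vec.subspace (range ((*v) P))"
    by (intro vec.subspace_image vec.subspace_UNIV)
  show "vec.dim (range ((*v) P)) \<le> card {x. f x = i} - 1"
    unfolding P_def by (rule dim_range_block_centering)
  show "P ** A ** P *v u \<in> range ((*v) P)" for u
    by (simp add: matrix_vector_mul_assoc[symmetric])
  show "column j (P ** Y) \<in> range ((*v) P)" for j
    by (auto simp: column_def matrix_matrix_mult_def matrix_vector_mult_def vec_eq_iff
        intro!: range_eqI[where x = "column j Y"])
qed

subsection \<open>Subconstituents of strongly regular graphs\<close>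

text \<open>The distance from \<open>x0\<close>, written without walks. The value 2 is the distance
  only when each remaining vertex shares a neighbour with \<open>x0\<close>.\<close>

definition subconstituent :: "('v \<Rightarrow> 'v \<Rightarrow> bool) \<Rightarrow> 'v \<Rightarrow> 'v \<Rightarrow> nat" where
  "subconstituent E x0 x = (if x = x0 then 0 else if E x0 x then 1 else 2)"

text \<open>Neighbours in cell 1 are common neighbours with \<open>x0\<close>, counted by
  \<open>k\<close>, \<open>l\<close> or \<open>m\<close>. Cell 0 contributes 0 or 1, and regularity
  then determines the count in cell 2.\<close>

lemma strongly_regular_equitable:
  assumes "strongly_regular E n k l m"
  shows "\<exists>q. \<forall>x j. card {z. E x z \<and> subconstituent E x0 z = j} = q (subconstituent E x0 x) j"
proof -
  let ?f = "subconstituent E x0"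
  have sym: "E x y \<longleftrightarrow> E y x" and irr: "\<not> E x x" for x y
    using assms by (auto simp: strongly_regular_def simple_graph_def symp_def irreflp_def)
  have deg: "card {z. E x z} = k" for x
    using assms by (simp add: strongly_regular_def regular_graph_def)
  have adj: "E x y \<Longrightarrow> card {z. E x z \<and> E y z} = l" for x y
    using assms by (simp add: strongly_regular_def)
  have nadj: "x \<noteq> y \<Longrightarrow> \<not> E x y \<Longrightarrow> card {z. E x z \<and> E y z} = m" for x y
    using assms by (simp add: strongly_regular_def)
  define c where "c x j = card {z. E x z \<and> ?f z = j}" for x j
  have 0: "c x 0 = (if ?f x = 1 then 1 else 0)" for x
  proof -
    have "{z. E x z \<and> ?f z = 0} = (if ?f x = 1 then {x0} else {})"
      using sym irr by (auto simp: subconstituent_def)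
    then show ?thesis by (simp add: c_def)
  qed
  have 1: "c x 1 = (if ?f x = 0 then k else if ?f x = 1 then l else m)" for x
  proof -
    have "{z. E x z \<and> ?f z = 1} = {z. E x0 z \<and> E x z}"
      using irr by (auto simp: subconstituent_def)
    then show ?thesis
      using adj[of x0 x] nadj[of x0 x] deg[of x0] by (auto simp: c_def subconstituent_def)
  qed
  have sum: "k = c x 0 + c x 1 + c x 2" for x
  proof -
    have "{z. E x z} = ({z. E x z \<and> ?f z = 0} \<union> {z. E x z \<and> ?f z = 1}) \<union> {z. E x z \<and> ?f z = 2}"
      by (auto simp: subconstituent_def)
    then have "k = card \<dots>" using deg by metis
    also have "\<dots> = c x 0 + c x 1 + c x 2"
      unfolding c_def by (subst card_Un_disjoint; auto)+
    finally show ?thesis .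
  qed
  have big: "c x j = 0" if "j > 2" for x j
    using that by (auto simp: c_def subconstituent_def)
  have "c x j = c y j" if "?f x = ?f y" for x y j
  proof -
    have "c x 0 = c y 0" "c x 1 = c y 1" by (simp_all only: 0 1 that)
    then have "c x 2 = c y 2" using sum[of x] sum[of y] by linarith
    moreover have "j = 0 \<or> j = 1 \<or> j = 2 \<or> j > 2" by linarith
    ultimately show ?thesis using \<open>c x 0 = c y 0\<close> \<open>c x 1 = c y 1\<close> big by metis
  qed
  \<comment> \<open>The quotient matrix takes its entries from a chosen representative of each cell;
    on empty cells its value is arbitrary.\<close>
  then have "\<forall>x j. c x j = c (SOME y. ?f y = ?f x) j"
    by (metis (mono_tags, lifting) someI)
  then show ?thesis
    by (intro exI[of _ "\<lambda>a j. c (SOME y. ?f y = a) j"]) (simp add: c_def)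
qed

text \<open>A vertex other than \<open>x0\<close> and its neighbours has \<open>m\<close> common
  neighbours with \<open>x0\<close>. Connectedness forces \<open>m\<close> to be nonzero once such a
  vertex exists, so no distance exceeds 2.\<close>

lemma graph_dist_eq_subconstituent:
  assumes srg: "strongly_regular E n k l m" and conn: "connected_graph E"
  shows "graph_dist E x0 x = subconstituent E x0 x"
proof -
  have sym: "E x y \<longleftrightarrow> E y x" for x y
    using srg by (auto simp: strongly_regular_def simple_graph_def symp_def)
  have nadj: "x \<noteq> y \<Longrightarrow> \<not> E x y \<Longrightarrow> card {z. E x z \<and> E y z} = m" for x y
    using srg by (simp add: strongly_regular_def)
  have common: "\<exists>z. E x0 z \<and> E z y" if "y \<noteq> x0" "\<not> E x0 y" for y
  proof -
    \<comment> \<open>if \<open>m = 0\<close>, then \<open>x0\<close> and its neighbours form a connected component\<close>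
    have "m \<noteq> 0"
    proof
      assume "m = 0"
      then have none: "\<not> (E x0 z \<and> E w z)" if "x0 \<noteq> w" "\<not> E x0 w" for w z
        using nadj[OF that] by auto
      have "E\<^sup>*\<^sup>* x0 y" using conn by (simp add: connected_graph_def)
      then have "y = x0 \<or> E x0 y"
      proof induction
        case (step y z)
        then show ?case using none[of z y] sym[of y z] by auto
      qed simp
      then show False using that by blast
    qed
    then have "{z. E x0 z \<and> E y z} \<noteq> {}"
      using nadj[of x0 y] that by (metis card.empty)
    then obtain z where "E x0 z" "E y z" by blast
    then show ?thesis using sym[of y z] by auto
  qed
  consider "x = x0" | "x \<noteq> x0" "E x0 x" | "x \<noteq> x0" "\<not> E x0 x" by blast
  then show ?thesis
  proof cases
    case 1
    then show ?thesis by (simp add: graph_dist_def subconstituent_def)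
  next
    case 2
    then have "(LEAST d. (E ^^ d) x0 x) = 1"
      by (intro Least_equality) (auto simp: Suc_le_eq intro!: gr0I)
    with 2 show ?thesis by (simp add: graph_dist_def subconstituent_def)
  next
    case 3
    then obtain z where z: "E x0 z" "E z x" using common by blast
    have "(LEAST d. (E ^^ d) x0 x) = 2"
    proof (rule Least_equality)
      show "(E ^^ 2) x0 x" using z by (auto simp: numeral_2_eq_2)
      fix d assume "(E ^^ d) x0 x"
      with 3 have "d \<noteq> 0" "d \<noteq> 1" by (auto simp del: One_nat_def intro: ccontr)
      then show "2 \<le> d" by linarith
    qed
    with 3 show ?thesis by (simp add: graph_dist_def subconstituent_def)
  qed
qed

text \<open>The entries of the square count common neighbours: \<open>k\<close>, \<open>l\<close> or
  \<open>m\<close>. The last summand is \<open>m J\<close>.\<close>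

lemma strongly_regular_adjacency_square:
  fixes E :: "'v::finite \<Rightarrow> 'v \<Rightarrow> bool"
  assumes "strongly_regular E n k l m"
  shows "adjacency_matrix E ** adjacency_matrix E =
    cscale (of_nat k - of_nat m) (mat 1) + cscale (of_nat l - of_nat m) (adjacency_matrix E)
      + (\<chi> x y. of_nat m)"
proof -
  have sym: "E x y \<longleftrightarrow> E y x" and irr: "\<not> E x x" for x y
    using assms by (auto simp: strongly_regular_def simple_graph_def symp_def irreflp_def)
  have "(adjacency_matrix E ** adjacency_matrix E) $ x $ y = of_nat (card {z. E x z \<and> E y z})" for x y
  proof -
    have "(adjacency_matrix E ** adjacency_matrix E) $ x $ y = (\<Sum>z\<in>UNIV. if E x z \<and> E y z then 1 else 0)"
      unfolding matrix_matrix_mult_def adjacency_matrix_def by (simp, intro sum.cong) (auto simp: sym)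
    then show ?thesis by (simp add: sum.If_cases)
  qed
  moreover have "card {z. E x z \<and> E y z} = (if x = y then k else if E x y then l else m)" for x y
    using assms by (auto simp: strongly_regular_def regular_graph_def)
  ultimately show ?thesis
    by (simp add: vec_eq_iff cscale_def mat_def adjacency_matrix_def irr)
qed

text \<open>The first step of a path from \<open>x0\<close> to \<open>y\<close> ends in cell 1 if
  taken in the graph, and in cell 2 if taken in the complement.\<close>

lemma primitive_subconstituent_nonempty:
  assumes "irreflp E" "primitive_graph E" "y \<noteq> x0" "i = 1 \<or> i = 2"
  shows "\<exists>z. subconstituent E x0 z = i"
proof (cases "i = 1")
  case True
  have "E\<^sup>*\<^sup>* x0 y"
    using assms(2) by (simp add: primitive_graph_def connected_graph_def)
  then obtain z where "E x0 z"
    using assms(3) by (metis converse_rtranclpE)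
  moreover from this have "z \<noteq> x0" using assms(1) by (auto dest: irreflpD)
  ultimately show ?thesis using True by (intro exI[of _ z]) (simp add: subconstituent_def)
next
  case False
  have "(complement_graph E)\<^sup>*\<^sup>* x0 y"
    using assms(2) by (simp add: primitive_graph_def connected_graph_def)
  then obtain z where "complement_graph E x0 z"
    using assms(3) by (metis converse_rtranclpE)
  then show ?thesis
    using assms(4) False by (intro exI[of _ z]) (auto simp: subconstituent_def complement_graph_def)
qed

lemma subconstituent_card_sum:
  fixes E :: "'v::finite \<Rightarrow> 'v \<Rightarrow> bool"
  shows "CARD('v) = 1 + card {x. subconstituent E x0 x = 1} + card {x. subconstituent E x0 x = 2}"
proof -
  have "(UNIV :: 'v set) = ({x0} \<union> {x. subconstituent E x0 x = 1}) \<union> {x. subconstituent E x0 x = 2}"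
    by (auto simp: subconstituent_def)
  then have "CARD('v) = card \<dots>" by simp
  also have "\<dots> = 1 + card {x. subconstituent E x0 x = 1} + card {x. subconstituent E x0 x = 2}"
    by (subst card_Un_disjoint; (auto simp: subconstituent_def)?)+
  finally show ?thesis .
qed

text \<open>This matrix averages over each cell. On the singleton cell of \<open>x0\<close>
  averaging is the identity, so only two centerings are subtracted.\<close>

lemma block_constant_centering_complement:
  "block_constant (subconstituent E x0)
     (mat 1 - block_centering (subconstituent E x0) 1 - block_centering (subconstituent E x0) 2)"
proof -
  let ?f = "subconstituent E x0"
  have "(mat 1 - block_centering ?f 1 - block_centering ?f 2) $ x $ y =
    (if ?f x = ?f y then if ?f x = 0 then 1 else 1 / of_nat (card {z. ?f z = ?f x}) else 0)" for x y
    by (auto simp: mat_def block_centering_def subconstituent_def)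
  then show ?thesis
    unfolding block_constant_def
    by (intro exI[of _ "\<lambda>a b. if a = b then if a = 0 then 1 else 1 / of_nat (card {z. ?f z = a}) else 0"]) simp
qed

theorem proposition5p2:
  fixes E :: "'v::finite \<Rightarrow> 'v \<Rightarrow> bool" and x0 :: 'v and n k l m :: nat
  assumes "strongly_regular E n k l m"
    and "primitive_graph E"
  shows "cmat.dim (terwilliger_algebra E x0) \<le> 2 * n + 3"
proof (cases "\<exists>y. y \<noteq> x0")
  \<comment> \<open>With a single vertex, cells 1 and 2 are empty and the general count breaks down,
    but every matrix is scalar.\<close>
  case False
  have "M = cscale (M $ x0 $ x0) (mat 1)" for M :: "complex ^ 'v ^ 'v"
    using False by (simp add: vec_eq_iff cscale_def mat_def) metis
  then have "terwilliger_algebra E x0 \<subseteq> cmat.span {mat 1}"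
    by (metis cmat.span_base cmat.span_scale singletonI subsetI)
  then have "cmat.dim (terwilliger_algebra E x0) \<le> card {mat 1 :: complex ^ 'v ^ 'v}"
    by (rule cmat.dim_le_card) simp
  then show ?thesis by simp
next
  case True
  then obtain y0 where y0: "y0 \<noteq> x0" by blast
  note srg = assms(1)
  have symE: "symp E" and irr: "irreflp E" and n: "CARD('v) = n"
    using srg by (auto simp: strongly_regular_def simple_graph_def)
  define f where "f = subconstituent E x0"
  define A where "A = adjacency_matrix E"
  define P where "P i = block_centering f i" for i
  define d where "d i = card {x. f x = i} - 1" for i
  obtain q where equitable: "\<And>x j. card {z. E x z \<and> f z = j} = q (f x) j"
    using strongly_regular_equitable[OF srg] unfolding f_def by metis
  have Pj: "block_constant f N \<Longrightarrow> N ** P i = 0" for N i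
    unfolding P_def by (rule block_constant_mult_block_centering)
  have idem: "P i ** P i = P i" for i
    by (simp add: P_def block_centering_idem)
  have AP: "A ** P i = P 1 ** A ** P i + P 2 ** A ** P i" for i
  proof -
    \<comment> \<open>The part of \<open>A ** P i\<close> outside the ranges of \<open>P 1\<close>
      and \<open>P 2\<close> comes from a block constant matrix, which \<open>P i\<close>
      kills.\<close>
    have "block_constant f ((mat 1 - P 1 - P 2) ** A)"
      unfolding A_def P_def f_def
      by (rule block_constant_mult_adjacency[OF symE block_constant_centering_complement])
         (rule equitable[unfolded f_def])
    then have "(mat 1 - P 1 - P 2) ** A ** P i = 0" by (rule Pj)
    then show ?thesis by (simp add: matrix_mult_diff_left matrix_mult_add_left algebra_simps)
  qed
  define \<alpha> \<nu> :: complex where "\<alpha> = of_nat k - of_nat m" and "\<nu> = of_nat l - of_nat m"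
  have PAAP: "P i ** A ** A ** P j = cscale \<alpha> (P i ** P j) + cscale \<nu> (P i ** A ** P j)" for i j
  proof -
    let ?J = "(\<chi> x y. of_nat m) :: complex ^ 'v ^ 'v"
    have "block_constant f ?J"
      by (auto simp: block_constant_def)
    then have "?J ** P j = 0" by (rule Pj)
    then have "A ** A ** P j = cscale \<alpha> (P j) + cscale \<nu> (A ** P j)"
      unfolding A_def strongly_regular_adjacency_square[OF srg] \<alpha>_def \<nu>_def
      by (simp add: matrix_mult_add_left cscale_mult_left)
    then have "P i ** (A ** A ** P j) = cscale \<alpha> (P i ** P j) + cscale \<nu> (P i ** (A ** P j))"
      by (simp add: matrix_add_ldistrib cscale_mult_right)
    then show ?thesis by (simp add: matrix_mul_assoc)
  qed
  define I where "I = (\<lambda>(i, j). block_indicator f i j) ` ({..<3} \<times> {..<3})"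
  \<comment> \<open>Taking \<open>X = P i\<close> gives the diagonal families \<open>B^r P_1\<close>
    and \<open>D^r P_2\<close>; taking \<open>X = A ** P (3 - i)\<close> gives \<open>B^r C\<close>
    and \<open>D^r G\<close>.\<close>
  define K where "K i X = krylov (P i ** A ** P i) (P i ** X) (d i)" for i X
  define F where "F = I \<union> K 1 (P 1) \<union> K 1 (A ** P 2) \<union> K 2 (P 2) \<union> K 2 (A ** P 1)"
  let ?S = "cmat.span F"
  have card: "card F \<le> 2 * n + 3"
  proof -
    have "card I \<le> 9" unfolding I_def
      by (rule order.trans[OF card_image_le]) (simp_all add: card_cartesian_product)
    moreover have "card (K i X) \<le> d i" for i X
      unfolding K_def by (rule card_krylov)
    ultimately have "card F \<le> 9 + d 1 + d 1 + d 2 + d 2"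
      unfolding F_def by (intro order.trans[OF card_Un_le] add_mono)
    \<comment> \<open>Both cells must be nonempty here, since \<open>d\<close> uses truncated
      subtraction.\<close>
    moreover have "d 1 + d 2 + 3 = n"
    proof -
      have "card {x. f x = i} \<noteq> 0" if "i = 1 \<or> i = 2" for i
        using primitive_subconstituent_nonempty[OF irr assms(2) y0 that] by (auto simp: f_def)
      from this[of 1] this[of 2] have "card {x. f x = 1} \<noteq> 0" "card {x. f x = 2} \<noteq> 0"
        by simp_all
      then show ?thesis
        using subconstituent_card_sum[of E x0] n unfolding d_def f_def by linarith
    qed
    ultimately show ?thesis by linarith
  qed
  have constS: "N \<in> ?S" if "block_constant f N" for N
  proof -
    have "f x < 3" for x by (simp add: f_def subconstituent_def)
    then have "N \<in> cmat.span I"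
      unfolding I_def using block_constant_mem_span[OF that] by blast
    moreover have "cmat.span I \<subseteq> ?S" by (rule cmat.span_mono) (auto simp: F_def)
    ultimately show ?thesis by blast
  qed
  \<comment> \<open>Every exponent \<open>r\<close> is allowed, although \<open>F\<close> contains
    only those below \<open>d i\<close>; raising an exponent thus never leaves the span. The index
    \<open>3 - i\<close> exchanges 1 and 2.\<close>
  have powS: "((**) (P i ** A ** P i) ^^ r) (P i ** X) \<in> ?S"
    if "i \<in> {1, 2}" "X \<in> {P i, A ** P (3 - i)}" for i X r
  proof -
    have "((**) (P i ** A ** P i) ^^ r) (P i ** X) \<in> cmat.span (K i X)"
      unfolding K_def P_def d_def by (rule corner_power_mem_span_krylov)
    moreover have "cmat.span (K i X) \<subseteq> ?S"
      using that by (intro cmat.span_mono) (auto simp: F_def)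
    ultimately show ?thesis by blast
  qed
  have cases_F: thesis
    if "Z \<in> F" "block_constant f Z \<Longrightarrow> thesis"
      "\<And>i X r. Z = ((**) (P i ** A ** P i) ^^ r) (P i ** X) \<Longrightarrow>
        i \<in> {1, 2} \<Longrightarrow> X \<in> {P i, A ** P (3 - i)} \<Longrightarrow> thesis" for Z thesis
  proof -
    have "block_constant f Z" if "Z \<in> I"
      using that by (auto simp: I_def block_indicator_def block_constant_def)
    moreover have "\<exists>r. Z = ((**) (P i ** A ** P i) ^^ r) (P i ** X)" if "Z \<in> K i X" for i X
      using that by (auto simp: K_def krylov_def)
    moreover have "F = I \<union> (\<Union>i\<in>{1, 2}. \<Union>X\<in>{P i, A ** P (3 - i)}. K i X)"
      by (auto simp: F_def)
    then have "Z \<in> I \<or> (\<exists>i X. i \<in> {1, 2} \<and> X \<in> {P i, A ** P (3 - i)} \<and> Z \<in> K i X)"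
      using that(1) by blast
    ultimately show thesis using that(2,3) by metis
  qed
  have subS: "cmat.subspace ?S" by (rule cmat.subspace_span)
  have A_inv: "A ** Y \<in> ?S" if "Y \<in> ?S" for Y
  proof (rule span_left_mult_closed[OF _ that])
    fix Z assume "Z \<in> F"
    then show "A ** Z \<in> ?S"
    proof (rule cases_F)
      assume "block_constant f Z"
      then show ?thesis
        unfolding A_def by (intro constS adjacency_mult_block_constant[where q = q] equitable)
    next
      fix i X r
      assume Z: "Z = ((**) (P i ** A ** P i) ^^ r) (P i ** X)"
        and i: "i \<in> {1, 2}" and X: "X \<in> {P i, A ** P (3 - i)}"
      define j where "j = 3 - i"
      have j: "j \<in> {1, 2}" "3 - j = i" "i = 1 \<and> j = 2 \<or> i = 2 \<and> j = 1"
        using i by (auto simp: j_def)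
      have AP': "A ** P s = P i ** A ** P s + P j ** A ** P s" for s
        using AP[of s] j(3) by (auto simp: add.commute)
      have "P j ** P i = 0"
        using j(3) by (auto simp: P_def block_centering_orthogonal)
      then have PAAP': "P j ** A ** A ** P i = cscale \<nu> (P j ** A ** P i)"
        using PAAP[of j i] by simp
      have pow: "((**) (P s ** A ** P s) ^^ r) (P s) \<in> ?S"
        "((**) (P s ** A ** P s) ^^ r) (P s ** A ** P (3 - s)) \<in> ?S" if "s \<in> {1, 2}" for s r
        using powS[OF that, of "P s" r] powS[OF that, of "A ** P (3 - s)" r]
        by (simp_all add: idem matrix_mul_assoc)
      show ?thesis
      \<comment> \<open>Multiplication by \<open>A\<close> links the diagonal family of one corner
        to the off-diagonal family of the other, so each case draws on one family from each
        corner.\<close>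
      proof (cases "X = P i")
        case True
        show ?thesis
          unfolding Z True idem
          using pow(1)[OF i] pow(2)[OF j(1)] unfolding j(2)
          by (rule corner_power_mult_mem[OF subS idem idem AP' PAAP' idem])
      next
        case False
        then have X': "P i ** X = P i ** A ** P j"
          using X by (simp add: j_def matrix_mul_assoc)
        have "P j ** A ** A ** P j = cscale \<alpha> (P j) + cscale \<nu> (P j ** A ** P j)"
          using PAAP[of j j] by (simp add: idem)
        then show ?thesis
          unfolding Z X'
          using pow(2)[OF i, folded j_def] pow(1)[OF j(1)]
          by (rule corner_power_mult_mem_off_diagonal[OF subS idem idem AP' AP' PAAP'])
      qed
    qed
  qed
  have diag_inv: "diag_idem {x. f x = j} ** Y \<in> ?S" if "Y \<in> ?S" for j Y
  proof (rule span_left_mult_closed[OF _ that])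
    fix Z assume "Z \<in> F"
    then show "diag_idem {x. f x = j} ** Z \<in> ?S"
    proof (rule cases_F)
      assume "block_constant f Z"
      then show ?thesis by (intro constS block_constant_diag_idem_mult)
    next
      fix i X r
      assume Z: "Z = ((**) (P i ** A ** P i) ^^ r) (P i ** X)"
      \<comment> \<open>The columns of \<open>Z\<close> are supported on block \<open>i\<close>, so
        a diagonal idempotent of the partition fixes or kills \<open>Z\<close>.\<close>
      then have "Z = P i ** Z"
        by (cases r) (simp_all add: matrix_mul_assoc idem)
      then have "diag_idem {x. f x = j} ** Z = diag_idem {x. f x = j} ** P i ** Z"
        by (simp add: matrix_mul_assoc[symmetric])
      also have "diag_idem {x. f x = j} ** P i = (if i = j then P i else 0)"
        by (simp add: P_def diag_idem_mult_block_centering)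
      also have "\<dots> ** Z = (if i = j then Z else 0)"
        using \<open>Z = P i ** Z\<close>[symmetric] by auto
      finally show ?thesis using \<open>Z \<in> F\<close> by (simp add: cmat.span_base cmat.span_zero)
    qed
  qed
  have "mat 1 \<in> ?S"
  proof -
    have "mat 1 - P 1 - P 2 \<in> ?S"
      unfolding P_def f_def by (intro constS[unfolded f_def] block_constant_centering_complement)
    moreover have "P 1 \<in> ?S" "P 2 \<in> ?S"
      using powS[of 1 "P 1" 0] powS[of 2 "P 2" 0] by (simp_all add: idem)
    ultimately have "(mat 1 - P 1 - P 2) + P 1 + P 2 \<in> ?S"
      by (intro cmat.span_add)
    then show ?thesis by simp
  qed
  moreover have "M ** Y \<in> ?S"
    if "M \<in> insert A {diag_idem (sphere_at E x0 i) | i. i \<le> eccentricity E x0}" "Y \<in> ?S" for M Y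
  proof -
    have "sphere_at E x0 i = {x. f x = i}" for i
      using graph_dist_eq_subconstituent[OF srg] assms(2)
      by (simp add: sphere_at_def f_def primitive_graph_def)
    then show ?thesis using that A_inv diag_inv by auto
  qed
  ultimately have "terwilliger_algebra E x0 \<subseteq> ?S"
    unfolding terwilliger_algebra_def A_def[symmetric]
    by (intro unital_subalgebra_hull_subset subS)
  moreover have "finite F" by (simp add: F_def I_def K_def)
  ultimately have "cmat.dim (terwilliger_algebra E x0) \<le> card F"
    by (rule cmat.dim_le_card)
  with card show ?thesis by linarith
qed

end
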